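(* The complete Urysohn space $\mathfrak{U}$ is geometrically Rado on any countable integer-distance free dense set. More precisely, let $G_1=(U_1,E_1)$ and $G_2=(U_2,E_2)$ be two g.e.c. graphs on countable integer-distance free dense sets $U_1,U_2\subseteq\mathfrak{U}$ respectively. Then $G_1$ and $G_2$ are isomorphic (as graphs).
   Context: The (complete) Urysohn space $\mathfrak{U}$ is the unique (up to isometry) complete separable metric space which contains an isometric copy of every separable metric space and is ultrahomogeneous: any isometry between finite subsets extends to an isometry of $\mathfrak{U}$ onto itself. A subset $U\subseteq\mathfrak{U}$ is integer-distance free if $d(x,y)\notin\mathbb{N}$ for all $x\ne y$ in $U$. A (simple, undirected) graph with vertex set a dense subset $S$ of a metric space $(X,d)$ is g.e.c. if (i) any two adjacent $u,v\in S$ satisfy $d(u,v)<1$; and (ii) for any $s\in S$, any disjoint finite $A,B\subseteq S$ contained in the open unit ball $B_1(s)$, and any $\epsilon>0$, there is $v\in S\setminus(A\cup B)$ with $d(s,v)<\epsilon$ adjacent to every vertex in $A$ and to no vertex in $B$. A metric space $(X,d)$ is geometrically Rado on a countable subset $V\subseteq X$ if two samplings of geometric random graphs on $V$ are almost surely isomorphic, where a geometric random graph on $V$ is obtained by making $x,y\in V$ adjacent, independently with probability $p\in(0,1)$, whenever $d(x,y)<1$ (and non-adjacent otherwise). Geometric random graphs on a countable dense set are almost surely g.e.c. *)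

theory Defs
  imports "HOL-Probability.Probability"
begin

section \<open>The Urysohn space\<close>

definition isometric_on :: "'a::metric_space set \<Rightarrow> ('a \<Rightarrow> 'a) \<Rightarrow> bool" where
  "isometric_on A f \<longleftrightarrow> (\<forall>x\<in>A. \<forall>y\<in>A. dist (f x) (f y) = dist x y)"

text \<open>HOL formulas cannot quantify over types, so the separable metric spaces are represented by
  those whose points are real numbers (the metric \<open>d\<close> is arbitrary). Separable metric spaces have at
  most continuum many points, so this loses nothing: see \<open>universal_separable_any_type\<close> below.\<close>

definition universal_separable :: "'a::metric_space set \<Rightarrow> bool" where
  "universal_separable X \<longleftrightarrow>
     (\<forall>(M::real set) d. Metric_space M d \<and> separable_space (Metric_space.mtopology M d) \<longrightarrow>
        (\<exists>f. f ` M \<subseteq> X \<and> (\<forall>x\<in>M. \<forall>y\<in>M. dist (f x) (f y) = d x y)))"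

definition ultrahomogeneous :: "'a::metric_space set \<Rightarrow> bool" where
  "ultrahomogeneous X \<longleftrightarrow>
     (\<forall>F f. finite F \<and> F \<subseteq> X \<and> f ` F \<subseteq> X \<and> isometric_on F f \<longrightarrow>
        (\<exists>g. g ` X = X \<and> isometric_on X g \<and> (\<forall>x\<in>F. g x = f x)))"

text \<open>The space is a subset \<open>X\<close> of a metric type, with the restricted metric; it need not be all of
  the type. In this way the definition can be satisfied in existing types such as
  bounded real sequences.\<close>

definition urysohn_space :: "'a::metric_space set \<Rightarrow> bool" where
  "urysohn_space X \<longleftrightarrow>
     Topological_Spaces.complete X \<and> separable_space (top_of_set X) \<and> universal_separable X \<and> ultrahomogeneous X"

lemma universal_separable_any_type:
  fixes X :: "'a::metric_space set" and M :: "'b set"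
  assumes X: "universal_separable X"
    and M: "Metric_space M d" "separable_space (Metric_space.mtopology M d)"
  shows "\<exists>f. f ` M \<subseteq> X \<and> (\<forall>x\<in>M. \<forall>y\<in>M. dist (f x) (f y) = d x y)"
proof -
  interpret Metric_space M d by (rule M(1))
  obtain C where C: "countable C" "C \<subseteq> M" "mtopology closure_of C = M"
    using M(2) by (auto simp: separable_space_def)
  have dense: "\<exists>y\<in>C. d x y < e" if "x \<in> M" "e > 0" for x e
  proof -
    have "x \<in> mtopology closure_of C" using that(1) C(3) by simp
    then show ?thesis using that(2) unfolding metric_closure_of by (auto simp: in_mball)
  qed
  define h where
    "h x = {prod_encode (to_nat_on C y, to_nat q) | y q. y \<in> C \<and> d x y < of_rat q}" for x
  have hD: "d x' y < of_rat q" if "h x = h x'" "y \<in> C" "d x y < of_rat q" for x x' y q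
  proof -
    have "prod_encode (to_nat_on C y, to_nat q) \<in> h x'"
      using that unfolding h_def by blast
    then show ?thesis
      using that(2) C(1) by (auto simp: h_def)
  qed
  have "inj_on h M"
  proof (rule inj_onI, rule ccontr)
    fix x x' assume xx: "x \<in> M" "x' \<in> M" "h x = h x'" "x \<noteq> x'"
    then have "d x x' / 2 > 0" using mdist_pos_less by auto
    then obtain q where q: "0 < real_of_rat q" "real_of_rat q < d x x' / 2"
      using of_rat_dense by blast
    then obtain y where y: "y \<in> C" "d x y < of_rat q"
      using dense xx(1) by blast
    have "d x' y < of_rat q" using hD[OF xx(3) y] .
    moreover have "d x x' \<le> d x y + d x' y"
      using triangle[of x y x'] xx y C(2) commute[of x' y] by auto
    ultimately show False using q y by linarith
  qed
  moreover obtain g :: "nat set \<Rightarrow> real" where "inj g"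
    using nat_sets_eqpoll_reals by (metis bij_betw_def eqpoll_def)
  ultimately have inj: "inj_on (g \<circ> h) M"
    by (meson comp_inj_on inj_on_subset subset_UNIV)
  define k where "k = g \<circ> h"
  define l where "l = inv_into M k"
  have lk: "l (k x) = x" if "x \<in> M" for x
    using that inj unfolding l_def k_def by (rule inv_into_f_f[rotated])
  define e where "e a b = d (l a) (l b)" for a b
  have ek: "e (k x) (k y) = d x y" if "x \<in> M" "y \<in> M" for x y
    using that by (simp add: e_def lk)
  have E: "Metric_space (k ` M) e"
    by unfold_locales (auto simp: e_def lk commute triangle)
  have "separable_space (Metric_space.mtopology (k ` M) e)"
    unfolding separable_space_def
  proof (intro exI conjI)
    show "countable (k ` C)" using C by simp
    show "k ` C \<subseteq> topspace (Metric_space.mtopology (k ` M) e)"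
      using C by (auto simp: Metric_space.topspace_mtopology[OF E])
    show "Metric_space.mtopology (k ` M) e closure_of (k ` C) =
            topspace (Metric_space.mtopology (k ` M) e)"
      unfolding Metric_space.metric_closure_of[OF E] Metric_space.topspace_mtopology[OF E]
      using dense C(2)
      by (auto simp: Metric_space.in_mball[OF E] ek subset_iff)
  qed
  then obtain f where f: "f ` k ` M \<subseteq> X"
      "\<forall>x\<in>k ` M. \<forall>y\<in>k ` M. dist (f x) (f y) = e x y"
    using X E unfolding universal_separable_def by blast
  show ?thesis
    using f by (intro exI[of _ "f \<circ> k"]) (auto simp: ek image_comp)
qed

definition integer_distance_free :: "'a::metric_space set \<Rightarrow> bool" where
  "integer_distance_free U \<longleftrightarrow> (\<forall>x\<in>U. \<forall>y\<in>U. x \<noteq> y \<longrightarrow> dist x y \<notin> \<nat>)"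

definition countable_dense_subset :: "'a::metric_space set \<Rightarrow> 'a set \<Rightarrow> bool" where
  "countable_dense_subset X S \<longleftrightarrow> countable S \<and> S \<subseteq> X \<and> X \<subseteq> closure S"


section \<open>Graphs\<close>

text \<open>The edges of a graph on \<open>V\<close> are two-element subsets of \<open>V\<close>.\<close>

definition simple_graph :: "'v set \<Rightarrow> 'v set set \<Rightarrow> bool" where
  "simple_graph V E \<longleftrightarrow> (\<forall>e\<in>E. e \<subseteq> V \<and> card e = 2)"

definition graph_isomorphic :: "'v set \<Rightarrow> 'v set set \<Rightarrow> 'w set \<Rightarrow> 'w set set \<Rightarrow> bool" where
  "graph_isomorphic V1 E1 V2 E2 \<longleftrightarrow>
     (\<exists>f. bij_betw f V1 V2 \<and> (\<forall>u\<in>V1. \<forall>v\<in>V1. {u, v} \<in> E1 \<longleftrightarrow> {f u, f v} \<in> E2))"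

definition gec :: "'a::metric_space set \<Rightarrow> 'a set \<Rightarrow> 'a set set \<Rightarrow> bool" where
  "gec X S E \<longleftrightarrow>
     S \<subseteq> X \<and> X \<subseteq> closure S \<and> simple_graph S E \<and>
     (\<forall>u\<in>S. \<forall>v\<in>S. {u, v} \<in> E \<longrightarrow> dist u v < 1) \<and>
     (\<forall>s\<in>S. \<forall>A B. \<forall>\<epsilon>>0.
        finite A \<and> finite B \<and> A \<inter> B = {} \<and> A \<subseteq> S \<inter> ball s 1 \<and> B \<subseteq> S \<inter> ball s 1 \<longrightarrow>
        (\<exists>v \<in> S - (A \<union> B). dist s v < \<epsilon> \<and> (\<forall>a\<in>A. {v, a} \<in> E) \<and> (\<forall>b\<in>B. {v, b} \<notin> E)))"


section \<open>Geometric random graphs\<close>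

definition near_pairs :: "'a::metric_space set \<Rightarrow> 'a set set" where
  "near_pairs V = {{x, y} | x y. x \<in> V \<and> y \<in> V \<and> x \<noteq> y \<and> dist x y < 1}"

text \<open>A sample \<open>\<omega>\<close> is a family of independent Bernoulli variables, one for each unordered pair at
  distance less than 1; \<open>sampled_edges V \<omega>\<close> is the edge set that it describes.\<close>

definition geometric_random_graph :: "'a::metric_space set \<Rightarrow> real \<Rightarrow> ('a set \<Rightarrow> bool) measure" where
  "geometric_random_graph V p = (\<Pi>\<^sub>M e\<in>near_pairs V. measure_pmf (bernoulli_pmf p))"

definition sampled_edges :: "'a::metric_space set \<Rightarrow> ('a set \<Rightarrow> bool) \<Rightarrow> 'a set set" where
  "sampled_edges V \<omega> = {e \<in> near_pairs V. \<omega> e}"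

text \<open>The two samples are independent, whence the product measure; their edge probabilities \<open>p\<close> and
  \<open>q\<close> are arbitrary in \<open>(0,1)\<close>, in particular they may be equal. Measurability of the
  isomorphism event is not presupposed: \<open>AE\<close> only asks that the exceptional set be contained
  in a null set.\<close>

definition geometrically_Rado :: "'a::metric_space set \<Rightarrow> 'a set \<Rightarrow> bool" where
  "geometrically_Rado X V \<longleftrightarrow>
     V \<subseteq> X \<and> countable V \<and>
     (\<forall>p\<in>{0<..<1}. \<forall>q\<in>{0<..<1}.
        AE \<omega> in geometric_random_graph V p \<Otimes>\<^sub>M geometric_random_graph V q.
          graph_isomorphic V (sampled_edges V (fst \<omega>)) V (sampled_edges V (snd \<omega>)))"

end

theory Submission
  imports Defs
begin

text \<open>
  The graphs are matched by a back-and-forth construction whose partial maps preserve adjacency and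
  the integer parts of distances. To extend such a map to a new vertex \<open>x\<close>, one needs in the target
  a point whose distance to the image of each earlier \<open>x\<^sub>i\<close> lies strictly between \<open>k\<^sub>i\<close> and
  \<open>k\<^sub>i + 1\<close>, where \<open>k\<^sub>i\<close> is the integer part of \<open>d(x, x\<^sub>i)\<close>. As all distances are non-integral,
  the function \<open>y \<mapsto> min\<^sub>i (k\<^sub>i + 1 - \<delta> + d(y, y\<^sub>i))\<close> is, for small \<open>\<delta>\<close>, an admissible distance
  function with these values, and the Urysohn space realises it. The condition is open, so the
  g.e.c. property provides a vertex near that point with the prescribed adjacencies.

  A sampled graph is almost surely g.e.c.: infinitely many vertices near \<open>s\<close> compete for a
  prescribed adjacency pattern, independently and each with the same positive probability.
\<close>

section \<open>One-point extensions\<close>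

text \<open>The conditions on \<open>h\<close> make \<open>F\<close> with one extra point a finite
  metric space. Universality places a copy of it in \<open>X\<close>, and ultrahomogeneity moves the
  copy of \<open>F\<close> back onto \<open>F\<close>; the extra point moves along and becomes
  \<open>u\<close>.\<close>

lemma urysohn_one_point_extension:
  fixes X :: "'a::metric_space set"
  assumes X: "urysohn_space X" and F: "finite F" "F \<subseteq> X"
    and pos: "\<And>x. x \<in> F \<Longrightarrow> 0 < h x"
    and lip: "\<And>x y. x \<in> F \<Longrightarrow> y \<in> F \<Longrightarrow> h x \<le> h y + dist x y"
    and sum: "\<And>x y. x \<in> F \<Longrightarrow> y \<in> F \<Longrightarrow> dist x y \<le> h x + h y"
  obtains u where "u \<in> X" "\<And>x. x \<in> F \<Longrightarrow> dist u x = h x"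
proof -
  \<comment> \<open>\<open>None\<close> is the extra point, at distance \<open>h x\<close> from
    \<open>Some x\<close>.\<close>
  define M where "M = insert None (Some ` F)"
  define d where "d a b = (case (a, b) of (None, None) \<Rightarrow> 0 | (None, Some y) \<Rightarrow> h y
      | (Some x, None) \<Rightarrow> h x | (Some x, Some y) \<Rightarrow> dist x y)" for a b
  have nonneg: "0 \<le> h x" if "x \<in> F" for x using pos[OF that] by simp
  have lip': "h y \<le> h x + dist x y" and lip'': "h x \<le> dist x y + h y" if "x \<in> F" "y \<in> F" for x y
    using lip[OF that] lip[OF that(2,1)] by (simp_all add: dist_commute add.commute)
  \<comment> \<open>The locale demands nonnegativity and symmetry also off the carrier.\<close>
  interpret d': Metric_space M "\<lambda>a b. if a \<in> M \<and> b \<in> M then d a b else 0"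
  proof
    fix a b c
    show "0 \<le> (if a \<in> M \<and> b \<in> M then d a b else 0)"
      by (auto simp: M_def d_def nonneg)
    show "(if a \<in> M \<and> b \<in> M then d a b else 0) = (if b \<in> M \<and> a \<in> M then d b a else 0)"
      by (auto simp: M_def d_def dist_commute)
    show "(if a \<in> M \<and> b \<in> M then d a b else 0) = 0 \<longleftrightarrow> a = b" if "a \<in> M" "b \<in> M"
      using that pos by (fastforce simp: M_def d_def)
    show "(if a \<in> M \<and> c \<in> M then d a c else 0) \<le> (if a \<in> M \<and> b \<in> M then d a b else 0) +
        (if b \<in> M \<and> c \<in> M then d b c else 0)" if "a \<in> M" "b \<in> M" "c \<in> M"
      using that by (auto simp: M_def d_def dist_triangle nonneg sum lip' lip'')
  qed
  have M_finite: "finite M" using F(1) by (simp add: M_def)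
  have "separable_space d'.mtopology"
    using F(1) closure_of_topspace[of d'.mtopology] unfolding separable_space_def
    by (intro exI[of _ M]) (simp add: countable_finite M_finite)
  moreover have "universal_separable X" using X by (simp add: urysohn_space_def)
  ultimately obtain f where f_sub: "f ` M \<subseteq> X"
    and "\<forall>a\<in>M. \<forall>b\<in>M. dist (f a) (f b) = (if a \<in> M \<and> b \<in> M then d a b else 0)"
    using universal_separable_any_type[OF _ d'.Metric_space_axioms] by blast
  then have f_dist: "dist (f a) (f b) = d a b" if "a \<in> M" "b \<in> M" for a b
    using that by simp
  define i where "i = f \<circ> Some"
  have i: "dist (i x) (i y) = dist x y" if "x \<in> F" "y \<in> F" for x y
    using that f_dist[of "Some x" "Some y"] by (simp add: M_def i_def d_def)
  have inj: "inj_on i F"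
    using i by (metis dist_eq_0_iff inj_onI)
  have i_sub: "i ` F \<subseteq> X" using f_sub by (auto simp: i_def M_def)
  \<comment> \<open>The embedding need not fix \<open>F\<close>. The inverse of its restriction
    \<open>i\<close> is an isometry between finite subsets of \<open>X\<close>, so it extends to all
    of \<open>X\<close>.\<close>
  have "\<exists>g. g ` X = X \<and> isometric_on X g \<and> (\<forall>x\<in>i ` F. g x = inv_into F i x)"
  proof -
    have "finite (i ` F)" "i ` F \<subseteq> X" "inv_into F i ` i ` F \<subseteq> X" "isometric_on (i ` F) (inv_into F i)"
      using F i_sub inj i by (auto simp: isometric_on_def)
    then show ?thesis using X unfolding urysohn_space_def ultrahomogeneous_def by blast
  qed
  then obtain g where g: "g ` X = X" "isometric_on X g" "\<And>x. x \<in> F \<Longrightarrow> g (i x) = x"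
    using inj by auto
  show thesis
  proof
    show "g (f None) \<in> X" using g(1) f_sub by (auto simp: M_def)
    fix x assume "x \<in> F"
    then have "dist (g (f None)) (g (i x)) = dist (f None) (i x)"
      using g(2) f_sub i_sub unfolding isometric_on_def by (auto simp: M_def)
    then show "dist (g (f None)) x = h x"
      using \<open>x \<in> F\<close> g(3) f_dist[of None "Some x"] by (simp add: M_def i_def d_def)
  qed
qed

text \<open>Extend from \<open>{s}\<close> with the constant value \<open>e / 2\<close>. This later
  supplies infinitely many vertices in each ball.\<close>

lemma urysohn_space_islimpt:
  assumes X: "urysohn_space X" and "s \<in> X"
  shows "s islimpt X"
  unfolding islimpt_approachable
proof (intro allI impI)
  fix e :: real assume "0 < e"
  then obtain u where "u \<in> X" "dist u s = e / 2"
    using urysohn_one_point_extension[OF X, of "{s}" "\<lambda>_. e / 2"] \<open>s \<in> X\<close> by auto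
  then show "\<exists>u\<in>X. u \<noteq> s \<and> dist u s < e"
    using \<open>0 < e\<close> by (intro bexI[of _ u]) auto
qed

text \<open>Take the minimum over \<open>z\<close> of \<open>k z + 1 - \<delta> + dist y z\<close>.
  It is 1-Lipschitz as a minimum of 1-Lipschitz functions, the term \<open>z = y\<close> keeps it
  below \<open>k y + 1\<close>, \<open>low\<close> keeps every term above \<open>k y\<close>, and
  \<open>upp\<close> yields the bound on \<open>dist y z\<close>.\<close>

lemma step_distance_function:
  fixes k :: "'a::metric_space \<Rightarrow> real"
  assumes F: "finite F" and k0: "\<And>y. y \<in> F \<Longrightarrow> 0 \<le> k y"
    and low: "\<And>y z. y \<in> F \<Longrightarrow> z \<in> F \<Longrightarrow> y \<noteq> z \<Longrightarrow> k y < k z + 1 + dist y z"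
    and upp: "\<And>y z. y \<in> F \<Longrightarrow> z \<in> F \<Longrightarrow> y \<noteq> z \<Longrightarrow> dist y z < k y + k z + 2"
  obtains h where "\<And>y. y \<in> F \<Longrightarrow> k y < h y \<and> h y < k y + 1"
    "\<And>y z. y \<in> F \<Longrightarrow> z \<in> F \<Longrightarrow> h y \<le> h z + dist y z"
    "\<And>y z. y \<in> F \<Longrightarrow> z \<in> F \<Longrightarrow> dist y z \<le> h y + h z"
proof -
  \<comment> \<open>Finitely many strict inequalities with positive slack all tolerate a small
    \<delta>. The \<open>if\<close> below equals \<open>dist y z\<close> in both cases.\<close>
  have small: "\<forall>\<^sub>F \<delta> in at_right (0::real). \<delta> < c" if "0 < c" for c
    using order_tendstoD(2)[OF tendsto_ident_at that] .
  have "\<forall>\<^sub>F \<delta> in at_right (0::real). \<forall>y\<in>F. \<forall>z\<in>F.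
      \<delta> < k z + 1 + dist y z - k y \<and> \<delta> < (k y + k z + 2 - (if y = z then 0 else dist y z)) / 2"
  proof (intro eventually_ball_finite ballI eventually_conj small F)
    fix y z assume yz: "y \<in> F" "z \<in> F"
    show "0 < k z + 1 + dist y z - k y"
      using low[OF yz] by (cases "y = z") auto
    show "0 < (k y + k z + 2 - (if y = z then 0 else dist y z)) / 2"
      using upp[OF yz] k0[OF yz(1)] k0[OF yz(2)] by simp
  qed
  then have "\<forall>\<^sub>F \<delta> in at_right (0::real). 0 < \<delta> \<and> (\<forall>y\<in>F. \<forall>z\<in>F.
      \<delta> < k z + 1 + dist y z - k y \<and> \<delta> < (k y + k z + 2 - (if y = z then 0 else dist y z)) / 2)"
    using eventually_at_right_less[of "0::real"] by eventually_elim auto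
  then obtain \<delta> where \<delta>: "0 < \<delta>"
      "\<And>y z. y \<in> F \<Longrightarrow> z \<in> F \<Longrightarrow> \<delta> < k z + 1 + dist y z - k y"
      "\<And>y z. y \<in> F \<Longrightarrow> z \<in> F \<Longrightarrow> 2 * \<delta> < k y + k z + 2 - (if y = z then 0 else dist y z)"
    by (auto dest!: eventually_happens simp: field_simps)
  define h where "h y = Min ((\<lambda>z. k z + 1 - \<delta> + dist y z) ` F)" for y
  have h_le: "h y \<le> k z + 1 - \<delta> + dist y z" if "z \<in> F" for y z
    unfolding h_def using F that by (intro Min_le) auto
  have h_eq: "\<exists>z\<in>F. h y = k z + 1 - \<delta> + dist y z" if "y \<in> F" for y
    unfolding h_def using F that Min_in[of "(\<lambda>z. k z + 1 - \<delta> + dist y z) ` F"] by fastforce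
  show thesis
  proof
    fix y assume y: "y \<in> F"
    obtain z where "z \<in> F" "h y = k z + 1 - \<delta> + dist y z" using h_eq[OF y] ..
    then show "k y < h y \<and> h y < k y + 1"
      using \<delta>(1) \<delta>(2)[OF y, of z] h_le[OF y, of y] by auto
  next
    fix y z assume y: "y \<in> F" and z: "z \<in> F"
    obtain z' where z': "z' \<in> F" "h z = k z' + 1 - \<delta> + dist z z'" using h_eq[OF z] ..
    obtain y' where y': "y' \<in> F" "h y = k y' + 1 - \<delta> + dist y y'" using h_eq[OF y] ..
    show "h y \<le> h z + dist y z"
      using h_le[OF z'(1), of y] z'(2) dist_triangle[of y z' z] by linarith
    \<comment> \<open>Go from \<open>y\<close> to \<open>z\<close> through the minimisers
      \<open>y'\<close> and \<open>z'\<close>; the middle leg is bounded by \<open>upp\<close> with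
      slack \<open>2 * \<delta>\<close>.\<close>
    have "dist y z \<le> dist y y' + dist y' z' + dist z z'"
      using dist_triangle[of y z y'] dist_triangle[of y' z z'] dist_commute[of z z'] by linarith
    moreover have "2 * \<delta> < k y' + k z' + 2 - dist y' z'"
      using \<delta>(3)[OF y'(1) z'(1)] by (auto split: if_splits)
    ultimately show "dist y z \<le> h y + h z"
      using y'(2) z'(2) by linarith
  qed
qed

section \<open>The back-and-forth construction\<close>

text \<open>Since \<open>Q\<close> constrains only two pairs at a time, it passes to the union of an
  increasing chain: any two pairs of the union lie in a common stage.\<close>

lemma back_and_forth:
  assumes count: "countable A" "countable B"
    and dom_ext: "\<And>R a. finite R \<Longrightarrow> R \<subseteq> A \<times> B \<Longrightarrow> \<forall>p\<in>R. \<forall>q\<in>R. Q p q \<Longrightarrow> a \<in> A \<Longrightarrow> a \<notin> Domain R \<Longrightarrow>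
      \<exists>b\<in>B. \<forall>p\<in>insert (a, b) R. \<forall>q\<in>insert (a, b) R. Q p q"
    and ran_ext: "\<And>R b. finite R \<Longrightarrow> R \<subseteq> A \<times> B \<Longrightarrow> \<forall>p\<in>R. \<forall>q\<in>R. Q p q \<Longrightarrow> b \<in> B \<Longrightarrow> b \<notin> Range R \<Longrightarrow>
      \<exists>a\<in>A. \<forall>p\<in>insert (a, b) R. \<forall>q\<in>insert (a, b) R. Q p q"
  obtains T where "T \<subseteq> A \<times> B" "Domain T = A" "Range T = B" "\<forall>p\<in>T. \<forall>q\<in>T. Q p q"
proof -
  define P where "P R \<longleftrightarrow> finite R \<and> R \<subseteq> A \<times> B \<and> (\<forall>p\<in>R. \<forall>q\<in>R. Q p q)" for R
  have add_dom: "\<exists>R'. P R' \<and> R \<subseteq> R' \<and> a \<in> Domain R'" if R: "P R" and a: "a \<in> A" for R a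
  proof (cases "a \<in> Domain R")
    case False
    obtain b where "b \<in> B" "\<forall>p\<in>insert (a, b) R. \<forall>q\<in>insert (a, b) R. Q p q"
      using dom_ext[OF _ _ _ a False] R unfolding P_def by blast
    then show ?thesis
      using that unfolding P_def by (intro exI[of _ "insert (a, b) R"]) auto
  qed (use that in blast)
  have add_ran: "\<exists>R'. P R' \<and> R \<subseteq> R' \<and> b \<in> Range R'" if R: "P R" and b: "b \<in> B" for R b
  proof (cases "b \<in> Range R")
    case False
    obtain a where "a \<in> A" "\<forall>p\<in>insert (a, b) R. \<forall>q\<in>insert (a, b) R. Q p q"
      using ran_ext[OF _ _ _ b False] R unfolding P_def by blast
    then show ?thesis
      using that unfolding P_def by (intro exI[of _ "insert (a, b) R"]) auto
  qed (use that in blast)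
  \<comment> \<open>Stage \<open>n\<close> absorbs the elements numbered \<open>n\<close> in
    \<open>A\<close> and in \<open>B\<close>. There is at most one of each, and none beyond the end
    of a finite enumeration.\<close>
  have step: "\<exists>R'. P R' \<and> (R \<subseteq> R' \<and> (\<forall>a\<in>A. to_nat_on A a = n \<longrightarrow> a \<in> Domain R') \<and>
      (\<forall>b\<in>B. to_nat_on B b = n \<longrightarrow> b \<in> Range R'))" if "P R" for R n
  proof -
    have "\<exists>R'. P R' \<and> R \<subseteq> R' \<and> (\<forall>a\<in>A. to_nat_on A a = n \<longrightarrow> a \<in> Domain R')"
    proof (cases "\<exists>a\<in>A. to_nat_on A a = n")
      case True
      then obtain a where a: "a \<in> A" "to_nat_on A a = n" by blast
      then have "\<forall>a'\<in>A. to_nat_on A a' = n \<longrightarrow> a' = a"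
        using count(1) by auto
      with add_dom[OF that a(1)] show ?thesis by blast
    qed (use that in blast)
    then obtain R1 where R1: "P R1" "R \<subseteq> R1" "\<forall>a\<in>A. to_nat_on A a = n \<longrightarrow> a \<in> Domain R1"
      by blast
    have "\<exists>R'. P R' \<and> R1 \<subseteq> R' \<and> (\<forall>b\<in>B. to_nat_on B b = n \<longrightarrow> b \<in> Range R')"
    proof (cases "\<exists>b\<in>B. to_nat_on B b = n")
      case True
      then obtain b where b: "b \<in> B" "to_nat_on B b = n" by blast
      then have "\<forall>b'\<in>B. to_nat_on B b' = n \<longrightarrow> b' = b"
        using count(2) by auto
      with add_ran[OF R1(1) b(1)] show ?thesis by blast
    qed (use R1 in blast)
    then obtain R2 where "P R2" "R1 \<subseteq> R2" "\<forall>b\<in>B. to_nat_on B b = n \<longrightarrow> b \<in> Range R2"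
      by blast
    with R1 show ?thesis by (intro exI[of _ R2]) blast
  qed
  have "P {}" by (simp add: P_def)
  then have "\<exists>R. \<forall>n. P (R n) \<and> (R n \<subseteq> R (Suc n) \<and>
      (\<forall>a\<in>A. to_nat_on A a = n \<longrightarrow> a \<in> Domain (R (Suc n))) \<and>
      (\<forall>b\<in>B. to_nat_on B b = n \<longrightarrow> b \<in> Range (R (Suc n))))"
    by (intro dependent_nat_choice step) auto
  then obtain R where R: "\<And>n. P (R n)" "\<And>n. R n \<subseteq> R (Suc n)"
      "\<And>n a. a \<in> A \<Longrightarrow> to_nat_on A a = n \<Longrightarrow> a \<in> Domain (R (Suc n))"
      "\<And>n b. b \<in> B \<Longrightarrow> to_nat_on B b = n \<Longrightarrow> b \<in> Range (R (Suc n))"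
    by blast
  have mono: "R m \<subseteq> R n" if "m \<le> n" for m n
    using lift_Suc_mono_le[of R, OF R(2) that] .
  have sub: "R n \<subseteq> A \<times> B" for n
    using R(1)[of n] unfolding P_def by blast
  show thesis
  proof (rule that[of "\<Union>n. R n"])
    show "(\<Union>n. R n) \<subseteq> A \<times> B" using sub by blast
    have "a \<in> Domain (\<Union>n. R n)" if "a \<in> A" for a using R(3)[OF that refl] by blast
    moreover have "b \<in> Range (\<Union>n. R n)" if "b \<in> B" for b using R(4)[OF that refl] by blast
    ultimately show "Domain (\<Union>n. R n) = A" "Range (\<Union>n. R n) = B"
      using sub by blast+
    show "\<forall>p\<in>\<Union>n. R n. \<forall>q\<in>\<Union>n. R n. Q p q"
    proof safe
      fix a b a' b' m n assume "(a, b) \<in> R m" "(a', b') \<in> R n"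
      then have "(a, b) \<in> R (max m n)" "(a', b') \<in> R (max m n)"
        using mono[of m "max m n"] mono[of n "max m n"] by auto
      then show "Q (a, b) (a', b')"
        using R(1)[of "max m n"] unfolding P_def by blast
    qed
  qed
qed

section \<open>Partial isomorphisms up to integer parts of distances\<close>

text \<open>Imposed on all pairs of a relation, the first clause makes it the graph of an injective
  partial map. Integer parts leave room for approximation, which exact distances would not, yet
  still tell whether a distance is below 1.\<close>

definition compatible ::
    "'a::metric_space set set \<Rightarrow> 'b::metric_space set set \<Rightarrow> 'a \<times> 'b \<Rightarrow> 'a \<times> 'b \<Rightarrow> bool" where
  "compatible E1 E2 p q \<longleftrightarrow> (fst p = fst q \<longleftrightarrow> snd p = snd q) \<and>
     \<lfloor>dist (fst p) (fst q)\<rfloor> = \<lfloor>dist (snd p) (snd q)\<rfloor> \<and>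
     ({fst p, fst q} \<in> E1 \<longleftrightarrow> {snd p, snd q} \<in> E2)"

lemma compatible_sym: "compatible E1 E2 p q \<longleftrightarrow> compatible E1 E2 q p"
  unfolding compatible_def dist_commute[of "fst p"] dist_commute[of "snd p"]
    insert_commute[of "fst p"] insert_commute[of "snd p"]
    eq_commute[of "fst p"] eq_commute[of "snd p"] by (rule refl)

lemma compatible_swap: "compatible E1 E2 (prod.swap p) (prod.swap q) \<longleftrightarrow> compatible E2 E1 p q"
  unfolding compatible_def fst_swap snd_swap by (intro conj_cong eq_commute)

text \<open>The integer part of a distance is a natural number, so freeness excludes equality. The
  strictness later leaves room for \<delta>.\<close>

lemma floor_dist_less:
  assumes "integer_distance_free U" "x \<in> U" "y \<in> U" "x \<noteq> y"
  shows "of_int \<lfloor>dist x y\<rfloor> < dist x y"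
proof -
  have "of_int \<lfloor>dist x y\<rfloor> = (of_nat (nat \<lfloor>dist x y\<rfloor>) :: real)" by simp
  then have "dist x y \<noteq> of_int \<lfloor>dist x y\<rfloor>"
    using assms unfolding integer_distance_free_def by (metis of_nat_in_Nats)
  then show ?thesis using of_int_floor_le[of "dist x y"] by linarith
qed

lemma gec_vertex:
  assumes "gec X S E" "s \<in> S" "finite A" "finite B" "A \<inter> B = {}"
    "A \<subseteq> S \<inter> ball s 1" "B \<subseteq> S \<inter> ball s 1" "0 < \<epsilon>"
  obtains v where "v \<in> S" "dist s v < \<epsilon>" "\<forall>a\<in>A. {v, a} \<in> E" "\<forall>b\<in>B. {v, b} \<notin> E"
proof -
  have "\<forall>s\<in>S. \<forall>A B. \<forall>\<epsilon>>0.
      finite A \<and> finite B \<and> A \<inter> B = {} \<and> A \<subseteq> S \<inter> ball s 1 \<and> B \<subseteq> S \<inter> ball s 1 \<longrightarrow>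
      (\<exists>v \<in> S - (A \<union> B). dist s v < \<epsilon> \<and> (\<forall>a\<in>A. {v, a} \<in> E) \<and> (\<forall>b\<in>B. {v, b} \<notin> E))"
    using assms(1) unfolding gec_def by (elim conjE)
  from this[rule_format, OF assms(2,8)] assms(3-7) that show thesis
    by (metis DiffD1)
qed

text \<open>The image is found in three moves: an ideal point \<open>u\<close> of \<open>X\<close>,
  a vertex \<open>s\<close> near \<open>u\<close>, and a g.e.c. vertex \<open>v\<close> near
  \<open>s\<close> with the right adjacencies. The last two cost less than \<open>\<eta> / 2\<close>
  each, so \<open>v\<close> keeps the integer parts prescribed at \<open>u\<close>.\<close>

lemma gec_extension:
  fixes X :: "'a::metric_space set" and U1 :: "'b::metric_space set"
  assumes X: "urysohn_space X" and gec: "gec X U2 E2"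
    and E1: "simple_graph U1 E1" "\<And>u v. u \<in> U1 \<Longrightarrow> v \<in> U1 \<Longrightarrow> {u, v} \<in> E1 \<Longrightarrow> dist u v < 1"
    and free: "integer_distance_free U2"
    and R: "finite R" "R \<subseteq> U1 \<times> U2" "\<forall>p\<in>R. \<forall>q\<in>R. compatible E1 E2 p q"
    and x: "x \<in> U1" "x \<notin> Domain R"
  shows "\<exists>v\<in>U2. \<forall>p\<in>insert (x, v) R. \<forall>q\<in>insert (x, v) R. compatible E1 E2 p q"
proof -
  define F where "F = Range R"
  \<comment> \<open>\<open>g\<close> inverts the partial map \<open>R\<close>; \<open>k y\<close> is
    the integer part that the distance from the new vertex to \<open>y\<close> must have.\<close>
  define g where "g y = (SOME x. (x, y) \<in> R)" for y
  define k where "k y = real_of_int \<lfloor>dist x (g y)\<rfloor>" for y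
  have F: "finite F" "F \<subseteq> U2" unfolding F_def using R by (auto simp: finite_Range)
  have U2: "U2 \<subseteq> X" "X \<subseteq> closure U2" "simple_graph U2 E2"
      "\<And>u v. u \<in> U2 \<Longrightarrow> v \<in> U2 \<Longrightarrow> {u, v} \<in> E2 \<Longrightarrow> dist u v < 1"
    using gec unfolding gec_def by auto
  have g: "(g y, y) \<in> R" if "y \<in> F" for y
    using that unfolding g_def F_def by (metis Range_iff someI_ex)
  have g_unique: "g b = a" if "(a, b) \<in> R" for a b
    using that R(3) g[of b] unfolding F_def compatible_def by fastforce
  have k0: "0 \<le> k y" for y by (simp add: k_def)
  have floor_g: "\<lfloor>dist (g y) (g z)\<rfloor> = \<lfloor>dist y z\<rfloor>" if "y \<in> F" "z \<in> F" for y z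
    using R(3) g[OF that(1)] g[OF that(2)] unfolding compatible_def by fastforce
  \<comment> \<open>Integer parts turn the triangle inequality into one with an error of at most 1;
    strictness comes from the non-integral distance in \<open>U2\<close>.\<close>
  have low: "k y < k z + 1 + dist y z" if "y \<in> F" "z \<in> F" "y \<noteq> z" for y z
  proof -
    have "dist x (g y) \<le> dist x (g z) + dist (g y) (g z)"
      using dist_triangle2[of x "g y" "g z"] by simp
    then have "\<lfloor>dist x (g y)\<rfloor> \<le> \<lfloor>dist x (g z)\<rfloor> + \<lfloor>dist y z\<rfloor> + 1"
      using floor_g[OF that(1,2)] by linarith
    then have "k y \<le> k z + real_of_int \<lfloor>dist y z\<rfloor> + 1"
      unfolding k_def by linarith
    moreover have "of_int \<lfloor>dist y z\<rfloor> < dist y z"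
      using floor_dist_less[OF free] F that by blast
    ultimately show ?thesis by linarith
  qed
  \<comment> \<open>One unit is lost in adding integer parts, another in
    \<open>dist y z < \<lfloor>dist y z\<rfloor> + 1\<close>.\<close>
  have upp: "dist y z < k y + k z + 2" if "y \<in> F" "z \<in> F" for y z
  proof -
    have "dist (g y) (g z) \<le> dist x (g y) + dist x (g z)"
      using dist_triangle3[of "g y" "g z" x] by simp
    then have "\<lfloor>dist (g y) (g z)\<rfloor> \<le> \<lfloor>dist x (g y)\<rfloor> + \<lfloor>dist x (g z)\<rfloor> + 1"
      by linarith
    then show ?thesis
      using floor_g[OF that] unfolding k_def by linarith
  qed
  obtain h where h: "\<And>y. y \<in> F \<Longrightarrow> k y < h y \<and> h y < k y + 1"
    "\<And>y z. y \<in> F \<Longrightarrow> z \<in> F \<Longrightarrow> h y \<le> h z + dist y z"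
    "\<And>y z. y \<in> F \<Longrightarrow> z \<in> F \<Longrightarrow> dist y z \<le> h y + h z"
    using step_distance_function[OF F(1), of k] k0 low upp by blast
  have "F \<subseteq> X" using F U2 by blast
  moreover have "\<And>y. y \<in> F \<Longrightarrow> 0 < h y" using h(1) k0 by (meson le_less_trans)
  ultimately obtain u where u: "u \<in> X" "\<And>y. y \<in> F \<Longrightarrow> dist u y = h y"
    using urysohn_one_point_extension[OF X F(1), of h] h(2,3) by blast
  have "\<forall>\<^sub>F w in nhds u. \<forall>y\<in>F. k y < dist w y \<and> dist w y < k y + 1"
    using F(1)
  proof (intro eventually_ball_finite ballI eventually_conj)
    fix y assume y: "y \<in> F"
    have t: "((\<lambda>w. dist w y) \<longlongrightarrow> h y) (nhds u)"
      using u(2)[OF y] by (auto intro!: tendsto_eq_intros filterlim_ident)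
    show "\<forall>\<^sub>F w in nhds u. k y < dist w y" "\<forall>\<^sub>F w in nhds u. dist w y < k y + 1"
      using order_tendstoD[OF t] h(1)[OF y] by auto
  qed
  \<comment> \<open>Finitely many strict bounds on continuous functions persist near
    \<open>u\<close>.\<close>
  then obtain \<eta> where \<eta>: "0 < \<eta>"
      "\<And>w y. dist w u < \<eta> \<Longrightarrow> y \<in> F \<Longrightarrow> k y < dist w y \<and> dist w y < k y + 1"
    unfolding eventually_nhds_metric by blast
  obtain s where s: "s \<in> U2" "dist s u < \<eta> / 2"
    using u(1) U2(2) \<eta>(1) by (metis closure_approachable half_gt_zero subset_iff)
  \<comment> \<open>Prescribed neighbours and non-neighbours. \<open>B\<close> omits vertices with
    \<open>k y \<ge> 1\<close>: there the distance from \<open>v\<close> exceeds 1, which already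
    rules out an edge.\<close>
  define A where "A = {y \<in> F. {x, g y} \<in> E1}"
  define B where "B = {y \<in> F. {x, g y} \<notin> E1 \<and> k y = 0}"
  have gU: "g y \<in> U1" if "y \<in> F" for y using g[OF that] R(2) by blast
  have A0: "k y = 0" if "y \<in> A" for y
    using that E1(2)[OF x(1) gU, of y] unfolding A_def k_def by (simp add: floor_eq_iff)
  \<comment> \<open>g.e.c. wants \<open>A\<close> and \<open>B\<close> inside the unit ball about
    \<open>s\<close>; since \<open>s\<close> also lies within \<eta> of \<open>u\<close>,
    \<open>k y = 0\<close> gives this.\<close>
  have near: "dist s y < 1" if "y \<in> F" "k y = 0" for y
    using \<eta>(2)[of s y] s(2) \<eta>(1) that by simp
  have "finite A" "finite B" "A \<inter> B = {}" "A \<subseteq> U2 \<inter> ball s 1" "B \<subseteq> U2 \<inter> ball s 1"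
    using F A0 near unfolding A_def B_def by auto
  then obtain v where v: "v \<in> U2" "dist s v < \<eta> / 2"
      "\<forall>a\<in>A. {v, a} \<in> E2" "\<forall>b\<in>B. {v, b} \<notin> E2"
    using gec_vertex[OF gec s(1), of A B "\<eta> / 2"] \<eta>(1) by auto
  have "dist v u < \<eta>"
    using dist_triangle[of v u s] v(2) s(2) by (simp add: dist_commute)
  then have v_dist: "k y < dist v y" "dist v y < k y + 1" if "y \<in> F" for y
    using \<eta>(2) that by auto
  have new: "compatible E1 E2 (x, v) (a, y)" if ay: "(a, y) \<in> R" for a y
  proof -
    have y: "y \<in> F" and a: "a = g y" using ay g_unique by (auto simp: F_def)
    have "\<lfloor>dist v y\<rfloor> = \<lfloor>dist x a\<rfloor>"
      using v_dist[OF y] unfolding a k_def by linarith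
    moreover have "x \<noteq> a" using x(2) ay by blast
    moreover have "v \<noteq> y" using v_dist(1)[OF y] k0[of y] by auto
    moreover have "{x, a} \<in> E1 \<longleftrightarrow> {v, y} \<in> E2"
    proof (cases "y \<in> A \<or> y \<in> B")
      case True
      then show ?thesis using v(3,4) a unfolding A_def B_def by auto
    next
      case False
      then have "{x, a} \<notin> E1" "k y \<noteq> 0" using y a unfolding A_def B_def by auto
      moreover have "0 \<le> \<lfloor>dist x (g y)\<rfloor>" by simp
      moreover have "\<lfloor>dist x (g y)\<rfloor> \<noteq> 0" using \<open>k y \<noteq> 0\<close> unfolding k_def by (metis of_int_0)
      ultimately have "1 \<le> k y" unfolding k_def by linarith
      then have "{v, y} \<notin> E2"
        using U2(4)[OF v(1), of y] v_dist(1)[OF y] F(2) y by fastforce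
      with \<open>{x, a} \<notin> E1\<close> show ?thesis by simp
    qed
    ultimately show ?thesis unfolding compatible_def by simp
  qed
  \<comment> \<open>On the diagonal the candidate edges are singletons, which are edges of neither
    graph.\<close>
  have "compatible E1 E2 (x, v) (x, v)"
    using E1(1) U2(3) unfolding compatible_def simple_graph_def by fastforce
  then show ?thesis
    using v(1) new R(3) compatible_sym by (intro bexI[of _ v]) (auto, blast+)
qed

text \<open>Back-and-forth gives a relation that is total on both sides and pairwise compatible: the
  first clause of \<open>compatible\<close> makes it a bijection, the last an isomorphism.\<close>

lemma gec_graphs_isomorphic:
  fixes X :: "'a::metric_space set"
  assumes X: "urysohn_space X"
    and U1: "countable U1" "integer_distance_free U1" "gec X U1 E1"
    and U2: "countable U2" "integer_distance_free U2" "gec X U2 E2"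
  shows "graph_isomorphic U1 E1 U2 E2"
proof -
  have E: "simple_graph U1 E1" "\<And>u v. u \<in> U1 \<Longrightarrow> v \<in> U1 \<Longrightarrow> {u, v} \<in> E1 \<Longrightarrow> dist u v < 1"
    "simple_graph U2 E2" "\<And>u v. u \<in> U2 \<Longrightarrow> v \<in> U2 \<Longrightarrow> {u, v} \<in> E2 \<Longrightarrow> dist u v < 1"
    using U1(3) U2(3) unfolding gec_def by auto
  have dom_ext: "\<exists>b\<in>U2. \<forall>p\<in>insert (a, b) R. \<forall>q\<in>insert (a, b) R. compatible E1 E2 p q"
    if "finite R" "R \<subseteq> U1 \<times> U2" "\<forall>p\<in>R. \<forall>q\<in>R. compatible E1 E2 p q" "a \<in> U1" "a \<notin> Domain R" for R a
    using gec_extension[OF X U2(3) E(1,2) U2(2) that] .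
  have ran_ext: "\<exists>a\<in>U1. \<forall>p\<in>insert (a, b) R. \<forall>q\<in>insert (a, b) R. compatible E1 E2 p q"
    if R: "finite R" "R \<subseteq> U1 \<times> U2" "\<forall>p\<in>R. \<forall>q\<in>R. compatible E1 E2 p q" "b \<in> U2" "b \<notin> Range R" for R b
  proof -
    \<comment> \<open>The back step is the forth step for the converse relation, with the graphs
      exchanged.\<close>
    let ?R = "prod.swap ` R"
    have "finite ?R" "?R \<subseteq> U2 \<times> U1" "\<forall>p\<in>?R. \<forall>q\<in>?R. compatible E2 E1 p q" "b \<notin> Domain ?R"
      using R by (auto simp: compatible_swap[symmetric, of E2 E1])
    from gec_extension[OF X U1(3) E(3,4) U1(2) this(1-3) R(4) this(4)]
    obtain a where "a \<in> U1" "\<forall>p\<in>insert (b, a) ?R. \<forall>q\<in>insert (b, a) ?R. compatible E2 E1 p q" ..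
    moreover have "insert (b, a) ?R = prod.swap ` insert (a, b) R" by simp
    ultimately have "\<forall>p\<in>insert (a, b) R. \<forall>q\<in>insert (a, b) R. compatible E1 E2 p q"
      unfolding compatible_swap[symmetric, of E1 E2] by blast
    with \<open>a \<in> U1\<close> show ?thesis ..
  qed
  obtain T where T: "T \<subseteq> U1 \<times> U2" "Domain T = U1" "Range T = U2"
      "\<forall>p\<in>T. \<forall>q\<in>T. compatible E1 E2 p q"
    using back_and_forth[OF U1(1) U2(1) dom_ext ran_ext] by blast
  define f where "f x = (SOME y. (x, y) \<in> T)" for x
  have f: "(x, f x) \<in> T" if "x \<in> U1" for x
    using that T(2) unfolding f_def by (metis Domain_iff someI_ex)
  have c: "compatible E1 E2 (x, f x) (y, f y)" if "x \<in> U1" "y \<in> U1" for x y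
    using f that T(4) by blast
  have "bij_betw f U1 U2"
  proof (rule bij_betw_imageI)
    show "inj_on f U1" using c by (auto simp: inj_on_def compatible_def)
    have "y \<in> f ` U1" if "y \<in> U2" for y
    proof -
      obtain x where x: "(x, y) \<in> T" using \<open>y \<in> U2\<close> T(3) by blast
      then have "x \<in> U1" using T(1) by blast
      with x f[of x] T(4) have "compatible E1 E2 (x, y) (x, f x)" by blast
      then have "f x = y" by (simp add: compatible_def)
      with \<open>x \<in> U1\<close> show ?thesis by blast
    qed
    then show "f ` U1 = U2" using f T(1) by blast
  qed
  then show ?thesis
    using c unfolding graph_isomorphic_def compatible_def by auto
qed

section \<open>Geometric random graphs\<close>

text \<open>Restriction to \<open>I\<close> is the identity on the product space, so the joint law
  of the coordinates is the product measure itself, hence the product of its marginals.\<close>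

lemma indep_vars_PiM_coordinates:
  assumes "\<And>i. i \<in> I \<Longrightarrow> prob_space (M i)" "I \<noteq> {}"
  shows "prob_space.indep_vars (PiM I M) M (\<lambda>i \<omega>. \<omega> i) I"
proof -
  interpret prob_space "PiM I M" using assms by (intro prob_space_PiM) auto
  have "distr (PiM I M) (PiM I M) (\<lambda>\<omega>. \<lambda>i\<in>I. \<omega> i) = distr (PiM I M) (PiM I M) (\<lambda>\<omega>. \<omega>)"
    by (intro distr_cong refl) (auto simp: space_PiM intro: PiE_restrict)
  also have "\<dots> = PiM I M" by simp
  also have "\<dots> = (\<Pi>\<^sub>M i\<in>I. distr (PiM I M) (M i) (\<lambda>\<omega>. \<omega> i))"
    using assms by (intro PiM_cong refl distr_PiM_component[symmetric])
  finally show ?thesis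
    using assms(2) by (subst indep_vars_iff_distr_eq_PiM') auto
qed

text \<open>Blocks on disjoint coordinate sets are independent, and bounded size makes each match
  \<open>t\<close> with probability at least a fixed \<open>c > 0\<close>. All of \<open>n\<close>
  blocks fail with probability at most \<open>(1 - c) ^ n\<close>, which tends to 0.\<close>

lemma AE_pattern_occurs:
  fixes K :: "'j \<Rightarrow> 'i set" and t :: "'i \<Rightarrow> bool"
  assumes p: "0 < p" "p < 1" and L: "infinite L" and K: "\<And>j. j \<in> L \<Longrightarrow> K j \<subseteq> I"
    "\<And>j. j \<in> L \<Longrightarrow> finite (K j)" "\<And>j. j \<in> L \<Longrightarrow> card (K j) \<le> m" "disjoint_family_on K L"
  shows "AE \<omega> in PiM I (\<lambda>_. measure_pmf (bernoulli_pmf p)). \<exists>j\<in>L. \<forall>i\<in>K j. \<omega> i = t i"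
\<comment> \<open>Independence of the coordinates is available for nonempty \<open>I\<close>; for
  empty \<open>I\<close> every block is empty and the pattern holds vacuously.\<close>
proof (cases "I = {}")
  case True
  obtain j where "j \<in> L" using L by (metis ex_in_conv finite.emptyI)
  moreover have "K j = {}" using K(1)[OF \<open>j \<in> L\<close>] True by simp
  ultimately show ?thesis by (intro AE_I2) auto
next
  case False
  let ?b = "measure_pmf (bernoulli_pmf p)"
  let ?M = "PiM I (\<lambda>_. ?b)"
  interpret prob_space ?M by (intro prob_space_PiM measure_pmf.prob_space_axioms)
  define c where "c = (min p (1 - p)) ^ m"
  have c: "0 < c" "c \<le> 1" using p by (auto simp: c_def power_le_one)
  define S where "S j = (\<Pi>\<^sub>E i\<in>K j. {t i})" for j
  define Z where "Z j = space (PiM (K j) (\<lambda>_. ?b)) - S j" for j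
  \<comment> \<open>The failure event of block \<open>j\<close>, written as a preimage under
    restriction to \<open>K j\<close> so that independence of the restrictions applies.\<close>
  define W where "W j = (\<lambda>\<omega>. restrict \<omega> (K j)) -` Z j \<inter> space ?M" for j
  have sets_S: "S j \<in> sets (PiM (K j) (\<lambda>_. ?b))" if "j \<in> L" for j
    unfolding S_def using K(2)[OF that] by (intro sets_PiM_I_finite) auto
  then have sets_Z: "Z j \<in> sets (PiM (K j) (\<lambda>_. ?b))" if "j \<in> L" for j
    unfolding Z_def using that by auto
  have meas: "(\<lambda>\<omega>. restrict \<omega> (K j)) \<in> measurable ?M (PiM (K j) (\<lambda>_. ?b))" if "j \<in> L" for j
    using K(1)[OF that] by (rule measurable_restrict_subset)
  have W_iff: "\<omega> \<in> W j \<longleftrightarrow> \<omega> \<in> space ?M \<and> \<not> (\<forall>i\<in>K j. \<omega> i = t i)" for \<omega> j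
    unfolding W_def Z_def S_def by (auto simp: space_PiM PiE_iff)
  have sets_W: "W j \<in> events" if "j \<in> L" for j
    unfolding W_def using measurable_sets[OF meas sets_Z] that by blast
  have prob_W: "prob (W j) \<le> 1 - c" if "j \<in> L" for j
  proof -
    have eq: "space ?M - W j = prod_emb I (\<lambda>_. ?b) (K j) (S j)"
      using K(1)[OF that] by (auto simp: W_iff prod_emb_def S_def space_PiM PiE_iff)
    have "emeasure ?M (prod_emb I (\<lambda>_. ?b) (K j) (S j)) = (\<Prod>i\<in>K j. emeasure ?b {t i})"
      unfolding S_def using K(1,2)[OF that]
      by (intro emeasure_PiM_emb measure_pmf.prob_space_axioms) auto
    also have "\<dots> = ennreal (\<Prod>i\<in>K j. pmf (bernoulli_pmf p) (t i))"
      by (simp add: emeasure_pmf_single prod_ennreal)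
    finally have "prob (space ?M - W j) = (\<Prod>i\<in>K j. pmf (bernoulli_pmf p) (t i))"
      unfolding eq by (simp add: measure_def prod_nonneg)
    also have "\<dots> \<ge> (\<Prod>i\<in>K j. min p (1 - p))"
    proof (intro prod_mono)
      show "0 \<le> min p (1 - p) \<and> min p (1 - p) \<le> pmf (bernoulli_pmf p) (t i)" for i
        using p by (cases "t i") auto
    qed
    finally have "(min p (1 - p)) ^ card (K j) \<le> prob (space ?M - W j)" by simp
    moreover have "c \<le> (min p (1 - p)) ^ card (K j)"
      unfolding c_def using p K(3)[OF that] by (intro power_decreasing) auto
    ultimately show ?thesis using prob_compl[OF sets_W[OF that]] by linarith
  qed
  have ind: "indep_vars (\<lambda>j. PiM (K j) (\<lambda>_. ?b)) (\<lambda>j \<omega>. restrict \<omega> (K j)) L"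
    using indep_vars_restrict[OF indep_vars_PiM_coordinates[of I "\<lambda>_. ?b"] K(1,4)] False
    by (simp add: measure_pmf.prob_space_axioms)
  have prob_Int: "prob (\<Inter>j\<in>J. W j) \<le> (1 - c) ^ card J" if "finite J" "J \<noteq> {}" "J \<subseteq> L" for J
  proof -
    have "prob (\<Inter>j\<in>J. W j) = (\<Prod>j\<in>J. prob (W j))"
      unfolding W_def using indep_varsD[OF ind that(2,1,3), of Z] sets_Z that by blast
    also have "\<dots> \<le> (\<Prod>j\<in>J. 1 - c)"
      using prob_W that by (intro prod_mono) auto
    finally show ?thesis by simp
  qed
  \<comment> \<open>\<open>L\<close> may be uncountable; a sequence of distinct indices keeps the
    intersection of failures measurable.\<close>
  obtain a :: "nat \<Rightarrow> 'j" where a: "inj a" "range a \<subseteq> L"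
    using infinite_countable_subset[OF L] by blast
  define N where "N = (\<Inter>n. W (a n))"
  have sets_N: "N \<in> events" unfolding N_def using sets_W a by (intro sets.countable_INT) auto
  have "prob N \<le> (1 - c) ^ Suc n" for n
  proof -
    have "prob N \<le> prob (\<Inter>j\<in>a ` {..n}. W j)"
      using a sets_W by (intro finite_measure_mono) (auto simp: N_def intro!: sets.finite_INT)
    also have "\<dots> \<le> (1 - c) ^ Suc n"
      using prob_Int[of "a ` {..n}"] a card_image[of a "{..n}"] by (auto simp: inj_on_subset)
    finally show ?thesis .
  qed
  moreover have "(\<lambda>n. (1 - c) ^ Suc n) \<longlonglongrightarrow> 0"
    using c by (intro LIMSEQ_Suc LIMSEQ_power_zero) auto
  ultimately have "prob N \<le> 0" by (intro LIMSEQ_le_const) auto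
  then have "prob N = 0" by (simp add: measure_le_0_iff)
  show ?thesis
  proof (rule AE_I)
    show "{\<omega> \<in> space ?M. \<not> (\<exists>j\<in>L. \<forall>i\<in>K j. \<omega> i = t i)} \<subseteq> N"
      using a unfolding N_def by (auto simp: W_iff)
    show "emeasure ?M N = 0" using \<open>prob N = 0\<close> by (simp add: emeasure_eq_measure)
  qed (rule sets_N)
qed

section \<open>Almost sure g.e.c. property and the isomorphism of two samples\<close>

text \<open>For fixed \<open>s\<close>, \<open>A\<close>, \<open>B\<close>, \<epsilon>, infinitely
  many candidates near \<open>s\<close> have disjoint sets of potential edges to
  \<open>A \<union> B\<close>, so one almost surely shows the required pattern. Countably many such
  requirements suffice.\<close>

lemma AE_sampled_edges_gec:
  fixes X :: "'a::metric_space set"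
  assumes V: "countable_dense_subset X V" and lim: "\<And>s. s \<in> X \<Longrightarrow> s islimpt X"
    and p: "0 < p" "p < 1"
  shows "AE \<omega> in geometric_random_graph V p. gec X V (sampled_edges V \<omega>)"
proof -
  have V': "countable V" "V \<subseteq> X" "X \<subseteq> closure V"
    using V by (auto simp: countable_dense_subset_def)
  define good where "good s A B \<epsilon> \<omega> \<longleftrightarrow> (\<exists>v\<in>V - (A \<union> B). dist s v < \<epsilon> \<and>
    (\<forall>a\<in>A. {v, a} \<in> sampled_edges V \<omega>) \<and> (\<forall>b\<in>B. {v, b} \<notin> sampled_edges V \<omega>))" for s A B \<epsilon> \<omega>
  have AE_good: "AE \<omega> in geometric_random_graph V p. good s A B \<epsilon> \<omega>"
    if s: "s \<in> V" and A: "finite A" "A \<subseteq> V \<inter> ball s 1" and B: "finite B" "B \<subseteq> V \<inter> ball s 1"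
      and AB: "A \<inter> B = {}" and \<epsilon>: "0 < \<epsilon>" for s A B \<epsilon>
  proof -
    \<comment> \<open>Within \<open>r\<close> of \<open>s\<close>, every candidate is at distance
      below 1 from each point of \<open>A \<union> B\<close>. Inserting \<epsilon> also keeps the
      minimum defined when \<open>A \<union> B\<close> is empty.\<close>
    define r where "r = Min (insert \<epsilon> ((\<lambda>c. 1 - dist s c) ` (A \<union> B)))"
    have r: "0 < r" "r \<le> \<epsilon>" "\<And>c. c \<in> A \<union> B \<Longrightarrow> dist s c + r \<le> 1"
    proof -
      show "0 < r" unfolding r_def using A B \<epsilon> by (subst Min_gr_iff) auto
      show "r \<le> \<epsilon>" unfolding r_def using A B by (intro Min_le) auto
      fix c assume "c \<in> A \<union> B"
      then have "r \<le> 1 - dist s c" unfolding r_def using A B by (intro Min_le) auto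
      then show "dist s c + r \<le> 1" by simp
    qed
    define L where "L = V \<inter> ball s r - (A \<union> B)"
    define K where "K v = (\<lambda>c. {v, c}) ` (A \<union> B)" for v
    have "s islimpt V"
      using lim s V' by (metis islimpt_subset limpt_of_closure subsetD)
    then have "infinite (V \<inter> ball s r)"
      using r(1) unfolding islimpt_eq_infinite_ball by blast
    then have "infinite L" using A B unfolding L_def by simp
    moreover have near: "{v, c} \<in> near_pairs V" if "v \<in> L" "c \<in> A \<union> B" for v c
    proof -
      have "dist v c < 1"
        using r(3)[OF that(2)] that(1) dist_triangle[of v c s] by (auto simp: L_def dist_commute)
      then show ?thesis using that A B unfolding near_pairs_def L_def by blast
    qed
    moreover have "disjoint_family_on K L"
      \<comment> \<open>A common edge of two candidates would put one of them in
        \<open>A \<union> B\<close>, which \<open>L\<close> excludes.\<close>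
      unfolding disjoint_family_on_def K_def L_def by (auto simp: doubleton_eq_iff)
    moreover have K_near: "K v \<subseteq> near_pairs V" if "v \<in> L" for v
      using near[OF that] unfolding K_def by blast
    moreover have K_finite: "finite (K v)" "card (K v) \<le> card (A \<union> B)" for v
      using A B unfolding K_def by (simp_all add: card_image_le)
    \<comment> \<open>As \<open>v\<close> is not in \<open>A\<close>, the edge \<open>{v, c}\<close>
      meets \<open>A\<close> exactly when \<open>c \<in> A\<close>: a single pattern serves all
      candidates.\<close>
    ultimately have "AE \<omega> in geometric_random_graph V p. \<exists>v\<in>L. \<forall>e\<in>K v. \<omega> e = (e \<inter> A \<noteq> {})"
      unfolding geometric_random_graph_def using A B
      by (intro AE_pattern_occurs[where m = "card (A \<union> B)"] p) (auto simp only: K_near K_finite)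
    then show ?thesis
    proof eventually_elim
      case (elim \<omega>)
      then obtain v where v: "v \<in> L" "\<forall>e\<in>K v. \<omega> e = (e \<inter> A \<noteq> {})" by blast
      then have \<omega>: "\<omega> {v, c} \<longleftrightarrow> c \<in> A" if "c \<in> A \<union> B" for c
        using that unfolding K_def L_def by auto
      have "{v, c} \<in> sampled_edges V \<omega> \<longleftrightarrow> c \<in> A" if "c \<in> A \<union> B" for c
        using near[OF v(1) that] \<omega>[OF that] by (simp add: sampled_edges_def)
      then show ?case
        using v(1) r(2) AB unfolding good_def L_def by (intro bexI[of _ v]) auto
    qed
  qed
  \<comment> \<open>A countable set has countably many finite subsets, and the tolerances
    \<open>1 / Suc n\<close> stand for all \<epsilon>.\<close>
  let ?I = "V \<times> {A. finite A \<and> A \<subseteq> V} \<times> {B. finite B \<and> B \<subseteq> V} \<times> (UNIV :: nat set)"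
  have "AE \<omega> in geometric_random_graph V p. \<forall>(s, A, B, n)\<in>?I.
      A \<inter> B = {} \<and> A \<subseteq> ball s 1 \<and> B \<subseteq> ball s 1 \<longrightarrow> good s A B (1 / Suc n) \<omega>"
  proof (rule AE_ball_countable')
    show "countable ?I"
      using V'(1) by (intro countable_SIGMA countable_Collect_finite_subset) auto
  qed (auto intro!: AE_good)
  then show ?thesis
  proof eventually_elim
    case (elim \<omega>)
    have "good s A B \<epsilon> \<omega>" if "s \<in> V" "0 < \<epsilon>" "finite A" "finite B" "A \<inter> B = {}"
      "A \<subseteq> V \<inter> ball s 1" "B \<subseteq> V \<inter> ball s 1" for s A B \<epsilon>
    proof -
      obtain n where "1 / real (Suc n) < \<epsilon>" using \<open>0 < \<epsilon>\<close> by (rule nat_approx_posE)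
      moreover have "good s A B (1 / Suc n) \<omega>" using elim that by auto
      ultimately show ?thesis unfolding good_def by (meson less_trans)
    qed
    moreover have "simple_graph V (sampled_edges V \<omega>)"
      by (auto simp: simple_graph_def sampled_edges_def near_pairs_def)
    moreover have "dist u v < 1" if "{u, v} \<in> sampled_edges V \<omega>" for u v
      using that by (auto simp: sampled_edges_def near_pairs_def doubleton_eq_iff dist_commute)
    ultimately show ?case
      unfolding gec_def good_def by (intro conjI V'(2,3) allI ballI impI) auto
  qed
qed

text \<open>The projections of the product have laws \<open>M\<close> and \<open>N\<close>, so
  almost sure properties pull back; the second projection reduces to the first by swapping the
  factors.\<close>

lemma AE_pair_both:
  assumes "prob_space M" "prob_space N" "AE x in M. P x" "AE y in N. Q y"
  shows "AE z in M \<Otimes>\<^sub>M N. P (fst z) \<and> Q (snd z)"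
proof -
  interpret M: prob_space M by fact
  interpret N: prob_space N by fact
  interpret pair_prob_space M N ..
  have "AE z in distr (M \<Otimes>\<^sub>M N) M fst. P z"
    by (subst N.distr_pair_fst) fact
  then have "AE z in M \<Otimes>\<^sub>M N. P (fst z)"
    by (rule AE_distrD[rotated]) simp
  moreover have "distr (M \<Otimes>\<^sub>M N) N snd = distr (N \<Otimes>\<^sub>M M) N fst"
    by (subst distr_pair_swap) (simp add: distr_distr comp_def split_def)
  then have "distr (M \<Otimes>\<^sub>M N) N snd = N"
    using M.distr_pair_fst by (rule trans)
  then have "AE z in distr (M \<Otimes>\<^sub>M N) N snd. Q z"
    by (rule ssubst) fact
  then have "AE z in M \<Otimes>\<^sub>M N. Q (snd z)"
    by (rule AE_distrD[rotated]) simp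
  ultimately show ?thesis by eventually_elim simp
qed

theorem corollary6p2:
  fixes X :: "'a::metric_space set"
  assumes "urysohn_space X"
  shows "(\<forall>V. countable_dense_subset X V \<and> integer_distance_free V \<longrightarrow> geometrically_Rado X V) \<and>
    (\<forall>U1 E1 U2 E2.
       countable_dense_subset X U1 \<and> integer_distance_free U1 \<and> gec X U1 E1 \<and>
       countable_dense_subset X U2 \<and> integer_distance_free U2 \<and> gec X U2 E2 \<longrightarrow>
       graph_isomorphic U1 E1 U2 E2)"
proof (intro conjI allI impI)
  fix U1 E1 U2 E2
  assume "countable_dense_subset X U1 \<and> integer_distance_free U1 \<and> gec X U1 E1 \<and>
       countable_dense_subset X U2 \<and> integer_distance_free U2 \<and> gec X U2 E2"
  then show "graph_isomorphic U1 E1 U2 E2"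
    using gec_graphs_isomorphic[OF assms] unfolding countable_dense_subset_def by blast
next
  fix V assume V: "countable_dense_subset X V \<and> integer_distance_free V"
  then have V': "V \<subseteq> X" "countable V" by (auto simp: countable_dense_subset_def)
  show "geometrically_Rado X V"
    unfolding geometrically_Rado_def
  proof (intro conjI ballI V')
    fix p q :: real assume "p \<in> {0<..<1}" "q \<in> {0<..<1}"
    then have "AE \<omega> in geometric_random_graph V r. gec X V (sampled_edges V \<omega>)" if "r \<in> {p, q}" for r
      using that V urysohn_space_islimpt[OF assms] by (intro AE_sampled_edges_gec) auto
    moreover have "prob_space (geometric_random_graph V r)" for r
      unfolding geometric_random_graph_def by (intro prob_space_PiM measure_pmf.prob_space_axioms)
    ultimately have "AE \<omega> in geometric_random_graph V p \<Otimes>\<^sub>M geometric_random_graph V q.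
        gec X V (sampled_edges V (fst \<omega>)) \<and> gec X V (sampled_edges V (snd \<omega>))"
      by (intro AE_pair_both) auto
    \<comment> \<open>Where both samples are g.e.c., the deterministic isomorphism applies pointwise
      with both vertex sets equal to \<open>V\<close>.\<close>
    then show "AE \<omega> in geometric_random_graph V p \<Otimes>\<^sub>M geometric_random_graph V q.
        graph_isomorphic V (sampled_edges V (fst \<omega>)) V (sampled_edges V (snd \<omega>))"
    proof eventually_elim
      case (elim \<omega>)
      then show ?case using gec_graphs_isomorphic[OF assms] V V'(2) by blast
    qed
  qed
qed

end
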